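(* For all natural numbers $n$ and $r$ with $n$ odd, $$\sum_{i=0}^{r} q^{i(n+1)/2} \genfrac{[}{]}{0pt}{}{\frac{n-1}{2}+i}{i}_q \genfrac{[}{]}{0pt}{}{\frac{n-1}{2}+r-i}{r-i}_q = \genfrac{[}{]}{0pt}{}{n+r}{r}_q .$$
   Context: Natural numbers here are non-negative integers, and $q$ is an indeterminate. For non-negative integers $n, k$, the Gaussian polynomial ($q$-binomial coefficient) is $$\genfrac{[}{]}{0pt}{}{n}{k}_q = \frac{(q^n-1)(q^{n-1}-1)\cdots(q^{n-k+1}-1)}{(q^k-1)(q^{k-1}-1)\cdots(q-1)},$$ with the empty product (case $k=0$) equal to $1$, so $\genfrac{[}{]}{0pt}{}{n}{0}_q=\genfrac{[}{]}{0pt}{}{n}{n}_q=1$. The identity is an identity of polynomials in $q$. *)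

theory Defs
  imports "HOL-Computational_Algebra.Polynomial"
begin

(* The numerator (q^n - 1)(q^(n-1) - 1)...(q^(n-k+1) - 1), with q the indeterminate of Z[q].
   For k > n the factor with i = n is q^0 - 1 = 0, so truncated subtraction is harmless. *)
definition q_falling :: "nat \<Rightarrow> nat \<Rightarrow> int poly" where
  "q_falling n k = (\<Prod>i<k. monom 1 (n - i) - 1)"

(* The division is exact in Z[q]: see q_falling_nonzero and gaussian_mult_denominator. *)
definition gaussian :: "nat \<Rightarrow> nat \<Rightarrow> int poly" where
  "gaussian n k = q_falling n k div q_falling k k"

lemma q_falling_0 [simp]: "q_falling n 0 = 1"
  by (simp add: q_falling_def)

lemma q_falling_Suc_Suc: "q_falling (Suc n) (Suc k) = (monom 1 (Suc n) - 1) * q_falling n k"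
  unfolding q_falling_def by (subst prod.lessThan_Suc_shift) simp

lemma q_falling_Suc: "q_falling n (Suc k) = q_falling n k * (monom 1 (n - k) - 1)"
  by (simp add: q_falling_def)

lemma q_falling_eq_0:
  assumes "n < k"
  shows "q_falling n k = 0"
proof -
  have "\<exists>i\<in>{..<k}. monom 1 (n - i) - 1 = (0 :: int poly)"
    using assms by (intro bexI[of _ n]) auto
  then show ?thesis
    by (simp add: q_falling_def)
qed

lemma q_falling_nonzero: "q_falling k k \<noteq> 0"
proof -
  have "monom 1 m - 1 \<noteq> (0 :: int poly)" if "m > 0" for m
  proof
    assume "monom 1 m - 1 = (0 :: int poly)"
    then have "degree (monom (1 :: int) m) = degree (1 :: int poly)"
      by simp
    with that show False
      by (simp add: degree_monom_eq)
  qed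
  then show ?thesis
    by (simp add: q_falling_def)
qed

lemma q_falling_dvd: "q_falling k k dvd q_falling n k"
proof (induction n arbitrary: k)
  case 0
  show ?case
    by (cases k) (simp_all add: q_falling_eq_0)
next
  case (Suc n)
  show ?case
  proof (cases k)
    case 0
    then show ?thesis by simp
  next
    case (Suc j)
    show ?thesis
    proof (cases "j \<le> n")
      case True
      let ?Q = "\<lambda>m. monom 1 m - 1 :: int poly"
      have "?Q (Suc n) = ?Q (Suc j) + monom 1 (Suc j) * ?Q (n - j)"
        using True by (simp add: algebra_simps mult_monom)
      then have "q_falling (Suc n) (Suc j)
          = ?Q (Suc j) * q_falling n j + monom 1 (Suc j) * q_falling n (Suc j)"
        by (simp add: q_falling_Suc_Suc q_falling_Suc[of n j] algebra_simps)
      moreover have "q_falling (Suc j) (Suc j) dvd ?Q (Suc j) * q_falling n j"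
        unfolding q_falling_Suc_Suc by (intro mult_dvd_mono dvd_refl Suc.IH)
      moreover have "q_falling (Suc j) (Suc j) dvd monom 1 (Suc j) * q_falling n (Suc j)"
        by (intro dvd_mult Suc.IH)
      ultimately show ?thesis
        using Suc by simp
    next
      case False
      then show ?thesis
        using Suc by (simp add: q_falling_eq_0)
    qed
  qed
qed

lemma gaussian_mult_denominator: "gaussian n k * q_falling k k = q_falling n k"
  unfolding gaussian_def by (rule dvd_div_mult_self[OF q_falling_dvd])

end

theory Submission
  imports Defs "HOL-Computational_Algebra.Formal_Power_Series"
begin

text \<open>
  The Gaussian polynomials \<open>gaussian (m + i) i\<close> are the coefficients of the power series
  \<open>1 / ((1 - X) (1 - q X) \<dots> (1 - q^m X))\<close>: this is the \<open>q\<close>-binomial theorem with a negative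
  exponent, and it follows from the \<open>q\<close>-Pascal rule, because multiplying by \<open>1 - q^(m+1) X\<close>
  takes the series for \<open>m + 1\<close> back to the series for \<open>m\<close>.

  The theorem compares coefficients in a splitting of this product.  The factors with
  exponents \<open>0, \<dots>, b\<close> give the series for \<open>b\<close>; the factors with exponents
  \<open>b + 1, \<dots>, a + b + 1\<close> are those for \<open>a\<close> with \<open>X\<close> replaced by \<open>q^(b+1) X\<close>, which puts the weight
  \<open>q^(i (b+1))\<close> on the \<open>i\<close>-th coefficient; all factors together give the series for
  \<open>a + b + 1\<close>.  So the coefficient of \<open>X^r\<close> yields a \<open>q\<close>-analogue of the Vandermonde
  convolution in the parameters \<open>a\<close> and \<open>b\<close>.  For odd \<open>n\<close>, the choice
  \<open>a = b = (n - 1) / 2\<close> cuts the \<open>n + 1\<close> factors into two halves of equal size and gives the theorem.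
\<close>

unbundle fps_syntax

lemma gaussian_0_right [simp]: "gaussian n 0 = 1"
  by (simp add: gaussian_def)

lemma gaussian_self [simp]: "gaussian n n = 1"
  by (simp add: gaussian_def q_falling_nonzero)

text \<open>
  After clearing the common denominator, this is the splitting
  \<open>q^(n+1) - 1 = (q^(n-k) - 1) + q^(n-k) (q^(k+1) - 1)\<close> of the leading factor of the numerator.
\<close>
lemma gaussian_pascal:
  assumes "k \<le> n"
  shows "gaussian (Suc n) (Suc k) = gaussian n (Suc k) + monom 1 (n - k) * gaussian n k"
proof -
  let ?Q = "\<lambda>m. monom 1 m - 1 :: int poly"
  let ?D = "q_falling (Suc k) (Suc k)"
  have split: "?Q (Suc n) = ?Q (n - k) + monom 1 (n - k) * ?Q (Suc k)"
    using assms by (simp add: algebra_simps mult_monom)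
  have "gaussian (Suc n) (Suc k) * ?D = ?Q (Suc n) * q_falling n k"
    by (subst gaussian_mult_denominator) (rule q_falling_Suc_Suc)
  also have "\<dots> = q_falling n (Suc k) + monom 1 (n - k) * (?Q (Suc k) * q_falling n k)"
    unfolding split q_falling_Suc[of n k] by (simp only: algebra_simps)
  also have "?Q (Suc k) * q_falling n k = gaussian n k * ?D"
    by (simp only: gaussian_mult_denominator[of n k, symmetric] q_falling_Suc_Suc ac_simps)
  also have "q_falling n (Suc k) = gaussian n (Suc k) * ?D"
    by (simp only: gaussian_mult_denominator)
  finally have "gaussian (Suc n) (Suc k) * ?D
      = (gaussian n (Suc k) + monom 1 (n - k) * gaussian n k) * ?D"
    by (simp only: algebra_simps)
  then show ?thesis
    using q_falling_nonzero[of "Suc k"] by simp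
qed

text \<open>
  The scaling by \<open>c\<close> stands for the substitution of \<open>c X\<close> for \<open>X\<close>.
\<close>
definition gaussian_fps :: "int poly \<Rightarrow> nat \<Rightarrow> int poly fps" where
  "gaussian_fps c m = Abs_fps (\<lambda>i. c ^ i * gaussian (m + i) i)"

lemma gaussian_fps_nth [simp]: "gaussian_fps c m $ i = c ^ i * gaussian (m + i) i"
  by (simp add: gaussian_fps_def)

text \<open>For \<open>m = 0\<close> all coefficients are powers of \<open>c\<close>, and the series is geometric.\<close>
lemma gaussian_fps_0: "gaussian_fps c 0 * (1 - fps_const c * fps_X) = 1"
proof (rule fps_ext)
  fix i
  show "(gaussian_fps c 0 * (1 - fps_const c * fps_X)) $ i = 1 $ i"
    by (cases i) (simp_all add: right_diff_distrib mult.assoc[symmetric])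
qed

lemma gaussian_fps_Suc:
  "gaussian_fps c (Suc m) * (1 - fps_const (c * monom 1 (Suc m)) * fps_X) = gaussian_fps c m"
proof (rule fps_ext)
  fix i
  let ?F = "gaussian_fps c (Suc m)"
  show "(?F * (1 - fps_const (c * monom 1 (Suc m)) * fps_X)) $ i = gaussian_fps c m $ i"
  proof (cases i)
    case 0
    then show ?thesis by simp
  next
    case (Suc k)
    have "gaussian (Suc m + Suc k) (Suc k)
        = gaussian (m + Suc k) (Suc k) + monom 1 (Suc m) * gaussian (Suc m + k) k"
      using gaussian_pascal[of k "Suc m + k"] by simp
    then show ?thesis
      by (simp add: Suc right_diff_distrib mult.assoc[symmetric]) (simp add: algebra_simps)
  qed
qed

text \<open>
  The \<open>q\<close>-binomial theorem with a negative exponent.  Stating it as a product equal to \<open>1\<close> keeps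
  it inside the ring of power series over \<open>\<int>[q]\<close>, where division is not available in general.
\<close>
lemma gaussian_fps_mult_prod:
  "gaussian_fps c m * (\<Prod>j\<le>m. 1 - fps_const (c * monom 1 j) * fps_X) = 1"
proof (induction m)
  case 0
  then show ?case
    using gaussian_fps_0[of c] by simp
next
  case (Suc m)
  let ?f = "\<lambda>j. 1 - fps_const (c * monom 1 j) * fps_X"
  have "gaussian_fps c (Suc m) * (\<Prod>j\<le>Suc m. ?f j)
      = (gaussian_fps c (Suc m) * ?f (Suc m)) * (\<Prod>j\<le>m. ?f j)"
    by (simp only: prod.atMost_Suc ac_simps)
  also have "\<dots> = 1"
    by (simp only: gaussian_fps_Suc Suc.IH)
  finally show ?case .
qed

text \<open>
  Both sides are inverse to the product of the factors with exponents \<open>0, \<dots>, a + b + 1\<close>,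
  and inverses in a commutative ring are unique.
\<close>
lemma gaussian_fps_mult:
  "gaussian_fps (monom 1 (Suc b)) a * gaussian_fps 1 b = gaussian_fps 1 (Suc (a + b))"
proof -
  let ?f = "\<lambda>j. 1 - fps_const (monom 1 j) * fps_X :: int poly fps"
  let ?A = "gaussian_fps (monom 1 (Suc b)) a" and ?B = "gaussian_fps 1 b"
    and ?C = "gaussian_fps 1 (Suc (a + b))"
  let ?P = "\<Prod>j\<le>Suc (a + b). ?f j"
  have A: "?A * (\<Prod>j\<le>a. ?f (Suc b + j)) = 1"
    using gaussian_fps_mult_prod[of "monom 1 (Suc b)" a] by (simp add: mult_monom)
  have B: "?B * (\<Prod>j\<le>b. ?f j) = 1"
    using gaussian_fps_mult_prod[of 1 b] by simp
  have C: "?C * ?P = 1"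
    using gaussian_fps_mult_prod[of 1 "Suc (a + b)"] by simp
  have P: "?P = (\<Prod>j\<le>b. ?f j) * (\<Prod>j\<le>a. ?f (Suc b + j))"
    by (induction a) (simp_all add: ac_simps)
  have "(?A * ?B) * ?P = (?A * (\<Prod>j\<le>a. ?f (Suc b + j))) * (?B * (\<Prod>j\<le>b. ?f j))"
    unfolding P by (simp only: ac_simps)
  then have AB: "(?A * ?B) * ?P = 1"
    by (simp only: A B mult_1)
  have "?A * ?B = (?A * ?B) * (?C * ?P)"
    by (simp only: C mult_1_right)
  also have "\<dots> = ((?A * ?B) * ?P) * ?C"
    by (simp only: ac_simps)
  finally show ?thesis
    by (simp only: AB mult_1)
qed

lemma gaussian_convolution:
  "(\<Sum>i=0..r. monom 1 (i * Suc b) * gaussian (a + i) i * gaussian (b + (r - i)) (r - i))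
    = gaussian (Suc (a + b) + r) r"
proof -
  have "(gaussian_fps (monom 1 (Suc b)) a * gaussian_fps 1 b) $ r
      = gaussian_fps 1 (Suc (a + b)) $ r"
    by (simp only: gaussian_fps_mult)
  then show ?thesis
    by (simp add: fps_mult_nth monom_power mult.commute[of b])
qed

theorem theorem4:
  fixes n r :: nat
  assumes "odd n"
  shows "(\<Sum>i=0..r. monom 1 (i * (n + 1) div 2)
            * gaussian ((n - 1) div 2 + i) i
            * gaussian ((n - 1) div 2 + (r - i)) (r - i))
         = gaussian (n + r) r"
proof -
  obtain m where n: "n = 2 * m + 1"
    using assms by (auto elim: oddE)
  have half: "(n - 1) div 2 = m" and total: "Suc (m + m) = n"
    by (simp_all add: n)
  have "i * (n + 1) = 2 * (i * Suc m)" for i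
    by (simp add: n algebra_simps)
  then have exponent: "i * (n + 1) div 2 = i * Suc m" for i
    by simp
  show ?thesis
    unfolding half exponent using gaussian_convolution[of m m r] by (simp only: total)
qed

end
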